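(* Let $k,l\ge 1$ and $n\ge 3$ be integers, and write $\kappa:=\left\lceil\frac{l-1}{n-2}\right\rceil-1$. Suppose that $A_1,\ldots,A_{2\kappa+1}\subseteq[0,l]$ are sets of integers, each having at least $n$ elements, and such that none of them is contained in an arithmetic progression with difference greater than $1$. Then the sumset $A_1+\dots+A_{2\kappa+1}$ contains a block of consecutive integers of length $2(\kappa+1)(n-1)-l$, and moreover $2(\kappa+1)(n-1)-l>l$.
   Context: The sumset of sets $A_1,\ldots,A_m$ of integers is $A_1+\dots+A_m=\{a_1+\dots+a_m: a_i\in A_i\}$. $[a,b]$ denotes the set of integers $x$ with $a\le x\le b$. The length of a block of consecutive integers (or of an arithmetic progression) is the number of its terms minus $1$; thus a block of consecutive integers of length $L$ is a set $\{a,a+1,\ldots,a+L\}$.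
   Formalization: The strict inequality 2(κ+1)(n−1)−l > l fails when κ = 0 (e.g. l = 2, n = 3, A_1 = {0,1,2} gives equality), so it is proved as ≥ l in general and as > l whenever κ ≥ 1; the block claim is unchanged. *)

theory Defs
  imports Complex_Main "HOL-Library.Set_Algebras"
begin

text \<open>
  The sumset of a finite family of sets is the big sum of \<open>Set_Algebras\<close>; the lemma
  \<open>set_sum_alt\<close> there gives the usual elementwise description.
\<close>

text \<open>
  The length \<open>N\<close> of a progression or of a block \<open>{a..a + N}\<close> is its number of terms
  minus one.
\<close>

definition arith_prog :: "int \<Rightarrow> int \<Rightarrow> nat \<Rightarrow> int set" where
  "arith_prog a d N = (\<lambda>j. a + int j * d) ` {0..N}"

definition contains_block :: "int set \<Rightarrow> int \<Rightarrow> bool" where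
  "contains_block S L \<longleftrightarrow> (\<exists>a. {a..a + L} \<subseteq> S)"

end

theory Submission
  imports Defs
begin

text \<open>
  Translate each \<open>A i\<close> to have minimum \<open>0\<close> and order the sets by their maxima \<open>L i\<close>. If \<open>S\<close> is a sum of
  \<open>h - 1\<close> of the sets and \<open>A\<close> is a further one with the largest maximum \<open>L\<close>, then
  \<open>S + {0, L} \<subseteq> S + A\<close>, so that \<open>S + A\<close> has a new element in every residue class modulo \<open>L\<close> that it
  meets. Kneser's theorem modulo \<open>L\<close> provides a divisor \<open>d\<close> of \<open>L\<close> such that, modulo \<open>L\<close>, \<open>S + A\<close>
  is a union of residue classes modulo \<open>d\<close>, and a large number of them. Unless all classes occur, there is one which
  meets \<open>S + A\<close> but not \<open>S\<close>, and all the elements of \<open>S + A\<close> in that class are new. Altogether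
  \<open>card (S + A) \<ge> card S + min L (h * (n - 2) + 1)\<close>.

  Summing separately the \<open>\<kappa> + 1\<close> sets in even position and the \<open>\<kappa>\<close> sets in odd position, one gets two
  sets so dense that, by the box principle, their sum contains a long block.
\<close>

section \<open>Kneser's theorem\<close>

definition stab :: "'a::ab_group_add set \<Rightarrow> 'a set" where
  "stab C = {g. \<forall>x. x + g \<in> C \<longleftrightarrow> x \<in> C}"

lemma stabD: "g \<in> stab C \<Longrightarrow> x + g \<in> C \<longleftrightarrow> x \<in> C"
  by (simp add: stab_def)

lemma zero_in_stab [simp]: "0 \<in> stab C"
  by (simp add: stab_def)

lemma stab_add: "g \<in> stab C \<Longrightarrow> h \<in> stab C \<Longrightarrow> g + h \<in> stab C"
  by (simp add: stab_def add.assoc [symmetric])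

lemma stab_uminus: "g \<in> stab C \<Longrightarrow> - g \<in> stab C"
  unfolding stab_def mem_Collect_eq by (metis add_minus_cancel add.commute minus_add_cancel)

lemma stab_diff: "g \<in> stab C \<Longrightarrow> h \<in> stab C \<Longrightarrow> g - h \<in> stab C"
  using stab_add [OF _ stab_uminus] by fastforce

lemma stab_subset_translate: "c \<in> C \<Longrightarrow> stab C \<subseteq> (\<lambda>x. x - c) ` C"
proof
  fix g assume "c \<in> C" "g \<in> stab C"
  then have "c + g \<in> C" by (simp add: stabD)
  moreover have "g = (c + g) - c" by simp
  ultimately show "g \<in> (\<lambda>x. x - c) ` C" by blast
qed

lemma finite_stab: "finite C \<Longrightarrow> C \<noteq> {} \<Longrightarrow> finite (stab C)"
  using stab_subset_translate by (metis all_not_in_conv finite_imageI finite_subset)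

text \<open>Translation by \<open>g\<close> is injective and maps the finite set \<open>C\<close>
  into itself, hence onto itself; this supplies the reverse implication.\<close>

lemma stabI:
  assumes "finite C" "\<And>x. x \<in> C \<Longrightarrow> x + g \<in> C"
  shows "g \<in> stab C"
proof -
  have "(\<lambda>x. x + g) ` C = C"
    using assms by (intro card_subset_eq) (auto simp: card_image)
  then have "x \<in> C" if "x + g \<in> C" for x
    using that by (metis add_right_imp_eq imageE)
  then show ?thesis using assms(2) unfolding stab_def by blast
qed

lemma stab_mono_plus:
  assumes "finite A" "finite B"
  shows "stab A \<subseteq> stab (A + B)"
proof
  fix g assume g: "g \<in> stab A"
  show "g \<in> stab (A + B)"
  proof (rule stabI)
    fix x assume "x \<in> A + B"
    then obtain a b where "a \<in> A" "b \<in> B" "x = a + b" by (auto elim: set_plus_elim)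
    then show "x + g \<in> A + B"
      using g by (metis add.assoc add.commute set_plus_intro stabD)
  qed (simp add: assms finite_set_plus)
qed

lemma plus_stab [simp]: "C + stab C = C"
proof
  show "C + stab C \<subseteq> C" by (auto elim!: set_plus_elim simp: stabD)
  show "C \<subseteq> C + stab C" using set_plus_intro [OF _ zero_in_stab [of C]] by auto
qed

lemma stab_plus_stab [simp]: "stab C + stab C = stab C"
proof
  show "stab C + stab C \<subseteq> stab C" by (auto elim!: set_plus_elim simp: stab_add)
  show "stab C \<subseteq> stab C + stab C" using set_plus_intro [OF _ zero_in_stab [of C]] by fastforce
qed

section \<open>Cardinality plus stabilizer size under unions\<close>

text \<open>
  The coset \<open>x + (stab C1 + stab C2)\<close> is a grid with fibres of size \<open>card J\<close> on which \<open>C1\<close> is a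
  union of rows and \<open>C2\<close> a union of columns.
\<close>

lemma grid_difference_card:
  fixes C1 C2 :: "'a::ab_group_add set"
  assumes fin: "finite C1" "finite C2" and ne: "C1 \<noteq> {}" "C2 \<noteq> {}"
    and J: "J = stab C1 \<inter> stab C2"
    and U: "U = {h \<in> stab C2. x + h \<in> C1}" and V: "V = {h \<in> stab C1. x + h \<in> C2}"
  shows "card U * card (stab C1 - V) \<le> card (C1 - C2) * card J"
proof -
  have finU: "finite U" "finite (stab C1 - V)" "finite J"
    using finite_stab [OF fin(1) ne(1)] finite_stab [OF fin(2) ne(2)] by (auto simp: U J)
  let ?f = "\<lambda>(h2, h1). x + h1 + h2"
  let ?P = "U \<times> (stab C1 - V)"
  have im: "?f ` ?P \<subseteq> C1 - C2"
  proof clarify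
    fix h2 h1 assume h: "h2 \<in> U" "h1 \<in> stab C1" "h1 \<notin> V"
    have "x + h2 + h1 \<in> C1" using h by (simp add: U stabD)
    moreover have "x + h1 + h2 \<notin> C2" using h by (simp add: U V stabD)
    ultimately show "x + h1 + h2 \<in> C1 - C2" by (simp add: add_ac)
  qed
  have fib: "card {p \<in> ?P. ?f p = z} \<le> card J" for z
  proof (cases "{p \<in> ?P. ?f p = z} = {}")
    case False
    then obtain h2 h1 where h: "h2 \<in> U" "h1 \<in> stab C1" "x + h1 + h2 = z" by auto
    \<comment> \<open>Two preimages of \<open>z\<close> differ by a shift \<open>(- j, j)\<close>,
      and such a \<open>j\<close> lies in both stabilizers.\<close>
    have "{p \<in> ?P. ?f p = z} \<subseteq> (\<lambda>j. (h2 - j, h1 + j)) ` J"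
    proof
      fix p assume "p \<in> {p \<in> ?P. ?f p = z}"
      then obtain k2 k1 where p: "p = (k2, k1)" and k: "k2 \<in> U" "k1 \<in> stab C1" "x + k1 + k2 = z"
        by auto
      have "x + (k1 + k2) = x + (h1 + h2)" using h k by (simp add: add.assoc)
      then have eq: "k1 - h1 = h2 - k2" by (simp add: algebra_simps)
      have "k1 - h1 \<in> stab C1" using h k by (simp add: stab_diff)
      moreover have "h2 - k2 \<in> stab C2" using h k by (simp add: U stab_diff)
      ultimately have "k1 - h1 \<in> J" using eq by (simp add: J)
      moreover have "(k2, k1) = (h2 - (k1 - h1), h1 + (k1 - h1))"
        by (simp add: eq) (simp add: eq [symmetric])
      ultimately show "p \<in> (\<lambda>j. (h2 - j, h1 + j)) ` J" unfolding p by blast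
    qed
    then show ?thesis using finU(3) by (meson card_image_le card_mono finite_imageI order_trans)
  next
    case True
    then show ?thesis unfolding True by simp
  qed
  have "card ?P = (\<Sum>z\<in>?f ` ?P. card {p \<in> ?P. ?f p = z})"
    using sum.image_gen [of ?P "\<lambda>_. 1::nat" ?f] finU by simp
  also have "\<dots> \<le> card (?f ` ?P) * card J"
    using sum_bounded_above [of "?f ` ?P" "\<lambda>z. card {p \<in> ?P. ?f p = z}" "card J"] fib by simp
  also have "\<dots> \<le> card (C1 - C2) * card J"
    using im fin by (intro mult_right_mono card_mono) auto
  finally show ?thesis by (simp add: card_cartesian_product)
qed

text \<open>If \<open>x + stab C2\<close> lies in \<open>C1\<close>, or \<open>x + stab C1\<close>
  avoids \<open>C2\<close>, then that whole coset lies in \<open>C1 - C2\<close>. Otherwise both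
  grid bounds, for \<open>C1 - C2\<close> and for \<open>C2 - C1\<close>, have nonzero factors, and
  adding them gives one of the first two alternatives.\<close>

lemma card_union_stab_cases:
  fixes C1 C2 :: "'a::ab_group_add set"
  assumes fin: "finite C1" "finite C2" and ne: "C1 \<noteq> {}" "C2 \<noteq> {}"
    and x: "x \<in> C1" "x \<notin> C2"
    and J: "J = stab C1 \<inter> stab C2"
  shows "card (stab C1) \<le> card (C2 - C1) + card J \<or> card (stab C2) \<le> card (C1 - C2) + card J
     \<or> card (stab C1) \<le> card (C1 - C2)"
proof -
  define U where "U = {h \<in> stab C2. x + h \<in> C1}"
  define V where "V = {h \<in> stab C1. x + h \<in> C2}"
  have finS: "finite (stab C1)" "finite (stab C2)" using fin ne finite_stab by auto
  have fins: "finite U" "finite V" "finite J"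
    using finS by (auto simp: U_def V_def J)
  have Usub: "U \<subseteq> stab C2" and Vsub: "V \<subseteq> stab C1" by (auto simp: U_def V_def)
  consider "U = stab C2" | "V = {}" | "U \<noteq> stab C2" "V \<noteq> {}" by blast
  then show ?thesis
  proof cases
    case 1
    have "(+) x ` stab C2 \<subseteq> C1 - C2"
      using 1 x by (auto simp: U_def stabD)
    then have "card ((+) x ` stab C2) \<le> card (C1 - C2)" using fin by (intro card_mono) auto
    then show ?thesis by (simp add: card_image)
  next
    case 2
    have "(+) x ` stab C1 \<subseteq> C1 - C2"
      using 2 x by (auto simp: V_def stabD)
    then have "card ((+) x ` stab C1) \<le> card (C1 - C2)" using fin by (intro card_mono) auto
    then show ?thesis by (simp add: card_image)
  next
    case 3
    \<comment> \<open>Meant for \<open>U\<close>, \<open>V\<close> and their complements: being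
      nonempty unions of cosets of \<open>J\<close>, they have at least \<open>card J\<close>
      elements.\<close>
    have periodic: "card J \<le> card X" if "w \<in> X" "finite X" "\<And>w j. w \<in> X \<Longrightarrow> j \<in> J \<Longrightarrow> w + j \<in> X" for w X
    proof -
      have "(+) w ` J \<subseteq> X" using that by auto
      then have "card ((+) w ` J) \<le> card X" using that by (intro card_mono) auto
      then show ?thesis by (simp add: card_image)
    qed
    obtain u where u: "u \<in> stab C2" "u \<notin> U" using 3 Usub by blast
    obtain v where v: "v \<in> V" using 3 by blast
    have JU: "w + j \<in> U \<longleftrightarrow> w \<in> U" if "w \<in> stab C2" "j \<in> J" for w j
      using that by (auto simp: U_def J stab_add add.assoc [symmetric] stabD)
    have JV: "w + j \<in> V \<longleftrightarrow> w \<in> V" if "w \<in> stab C1" "j \<in> J" for w j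
      using that by (auto simp: V_def J stab_add add.assoc [symmetric] stabD)
    have "0 \<in> U" "0 \<notin> V" using x by (auto simp: U_def V_def)
    have b1: "card J \<le> card U"
      using \<open>0 \<in> U\<close> fins Usub JU by (intro periodic [of 0]) auto
    have b2: "card J \<le> card V"
      using v fins Vsub JV by (intro periodic [of v]) auto
    have b3: "card J \<le> card (stab C2 - U)"
      using u finS JU by (intro periodic [of u]) (auto simp: J stab_add)
    have b4: "card J \<le> card (stab C1 - V)"
      using \<open>0 \<notin> V\<close> finS JV by (intro periodic [of 0]) (auto simp: J stab_add)
    have g1: "card U * card (stab C1 - V) \<le> card (C1 - C2) * card J"
      by (rule grid_difference_card [OF fin ne J]) (auto simp: U_def V_def)
    have g2: "card V * card (stab C2 - U) \<le> card (C2 - C1) * card J"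
      by (rule grid_difference_card [OF fin(2,1) ne(2,1)]) (auto simp: U_def V_def J)
    have e1: "card (stab C2) = card U + card (stab C2 - U)"
      using Usub finS by (metis card_Diff_subset card_mono fins(1) le_add_diff_inverse)
    have e2: "card (stab C1) = card V + card (stab C1 - V)"
      using Vsub finS by (metis card_Diff_subset card_mono fins(2) le_add_diff_inverse)
    have "0 \<in> J" by (simp add: J)
    then have jpos: "card J > 0" using fins(3) by (auto simp: card_gt_0_iff)
    \<comment> \<open>From \<open>(a - j) * (b - j) \<ge> 0\<close> one gets
      \<open>j * (a + b) \<le> a * b + j * j \<le> j * (e + j)\<close>.\<close>
    have key: "a + b \<le> e + j" if "a * b \<le> e * j" "j \<le> a" "j \<le> b" "j > 0" for a b e j :: nat
    proof -
      obtain s t where st: "a = j + s" "b = j + t"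
        using le_Suc_ex [OF \<open>j \<le> a\<close>] le_Suc_ex [OF \<open>j \<le> b\<close>] by blast
      have "j * (j + s + t) \<le> j * e" using that st by (simp add: algebra_simps)
      then show ?thesis using st \<open>j > 0\<close> by simp
    qed
    \<comment> \<open>Added up, the two bounds give \<open>card (stab C1) + card (stab C2) \<le>
      card (C1 - C2) + card (C2 - C1) + 2 * card J\<close>, so the first two alternatives cannot
      both fail.\<close>
    show ?thesis
      using key [OF g1 b1 b4 jpos] key [OF g2 b2 b3 jpos] e1 e2 by linarith
  qed
qed

text \<open>Common periods of \<open>C1\<close> and \<open>C2\<close> are periods of the union. It
  remains to see that, for one of the two sets, what is lost in passing from its stabilizer to
  \<open>J\<close> is made up by the elements of the other.\<close>

lemma card_union_stab:
  fixes C1 C2 :: "'a::ab_group_add set"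
  assumes fin: "finite C1" "finite C2" and ne: "C1 \<noteq> {}" "C2 \<noteq> {}"
    and N: "N \<le> card C1 + card (stab C1)" "N \<le> card C2 + card (stab C2)"
  shows "N \<le> card (C1 \<union> C2) + card (stab (C1 \<union> C2))"
proof (cases "C1 \<subseteq> C2 \<or> C2 \<subseteq> C1")
  case True
  then show ?thesis using N by (metis sup.absorb1 sup.absorb2)
next
  case False
  then obtain x y where xy: "x \<in> C1" "x \<notin> C2" "y \<in> C2" "y \<notin> C1" by blast
  define J where "J = stab C1 \<inter> stab C2"
  have "J \<subseteq> stab (C1 \<union> C2)" by (auto simp: J_def stab_def)
  then have Jle: "card J \<le> card (stab (C1 \<union> C2))"
    using fin ne by (intro card_mono finite_stab) auto
  have u1: "card (C1 \<union> C2) = card C1 + card (C2 - C1)"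
    by (metis Diff_disjoint Un_Diff_cancel card_Un_disjoint fin finite_Diff)
  have u2: "card (C1 \<union> C2) = card C2 + card (C1 - C2)"
    by (metis Diff_disjoint Un_Diff_cancel Un_commute card_Un_disjoint fin finite_Diff)
  \<comment> \<open>If both alternatives failed, the two applications would leave
    \<open>card (stab C1) \<le> card (C1 - C2)\<close> and its mirror image, and each stabilizer
    would be larger than the other.\<close>
  have "card (stab C1) \<le> card (C2 - C1) + card J \<or> card (stab C2) \<le> card (C1 - C2) + card J"
    using card_union_stab_cases [OF fin ne xy(1,2) J_def]
      card_union_stab_cases [OF fin(2,1) ne(2,1) xy(3,4), of J]
    by (auto simp: J_def Int_commute)
  then show ?thesis using N u1 u2 Jle by linarith
qed

lemma card_Union_stab:
  fixes F :: "'a::ab_group_add set set"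
  assumes "finite F" "F \<noteq> {}"
    and "\<And>C. C \<in> F \<Longrightarrow> finite C \<and> C \<noteq> {} \<and> N \<le> card C + card (stab C)"
  shows "N \<le> card (\<Union>F) + card (stab (\<Union>F))"
  using assms
proof (induction rule: finite_ne_induct)
  case (insert C F)
  have "N \<le> card (C \<union> \<Union>F) + card (stab (C \<union> \<Union>F))"
    using insert by (intro card_union_stab) (auto simp: ex_in_conv)
  then show ?case by simp
qed simp

section \<open>Dyson transforms and Kneser's theorem for two summands\<close>

text \<open>
  Among the pairs \<open>(A', B')\<close> reachable from \<open>(A, B)\<close> by Dyson transforms keeping \<open>b\<close> in \<open>B'\<close>, one
  with \<open>A'\<close> of maximal size satisfies \<open>B' - b \<subseteq> stab A'\<close>.
\<close>

lemma dyson_transform_stab: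
  fixes A B :: "'a::ab_group_add set"
  assumes fin: "finite A" "finite B" and ne: "A \<noteq> {}" and b: "b \<in> B"
  obtains C where "(\<lambda>a. a + b) ` A \<subseteq> C" "C \<subseteq> A + B" "card A + card B \<le> card C + card (stab C)"
proof -
  define P where "P = (\<lambda>(A', B'). A \<subseteq> A' \<and> finite B' \<and> b \<in> B' \<and> A' + B' \<subseteq> A + B
      \<and> card A' + card B' = card A + card B)"
  have "P (A, B)" using assms by (simp add: P_def)
  moreover have "\<forall>p. P p \<longrightarrow> card (fst p) < Suc (card A + card B)" by (auto simp: P_def)
  ultimately obtain p where p: "P p" "\<And>q. P q \<Longrightarrow> card (fst q) \<le> card (fst p)"
    using ex_has_greatest_nat [of P "(A, B)" "\<lambda>p. card (fst p)"]
    by (metis less_Suc_eq_le)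
  obtain A' B' where q: "p = (A', B')" by force
  have AB: "A \<subseteq> A'" "finite B'" "b \<in> B'" "A' + B' \<subseteq> A + B" "card A' + card B' = card A + card B"
    using p(1) by (auto simp: P_def q)
  have "(\<lambda>a. a + b) ` A' \<subseteq> A + B" using AB by auto
  then have finA': "finite A'"
    using finite_set_plus [OF fin] by (metis add_right_imp_eq finite_imageD finite_subset inj_onI)
  have step: "a + (c - b) \<in> A'" if a: "a \<in> A'" and c: "c \<in> B'" for a c
  proof -
    \<comment> \<open>The shift is chosen so that \<open>b + e = a\<close> lies in
      \<open>A'\<close>; thus \<open>b\<close> survives in \<open>B2\<close>. Maximality then forces
      \<open>B' + e \<subseteq> A'\<close>.\<close>
    define e where "e = a - b"
    define A2 where "A2 = A' \<union> (\<lambda>y. y + e) ` B'"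
    define B2 where "B2 = {y \<in> B'. y + e \<in> A'}"
    have "card A2 + card ((\<lambda>y. y + e) ` B2) = card A' + card ((\<lambda>y. y + e) ` B')"
    proof -
      have "(\<lambda>y. y + e) ` B2 = A' \<inter> (\<lambda>y. y + e) ` B'" by (auto simp: B2_def)
      then show ?thesis using card_Un_Int [of A' "(\<lambda>y. y + e) ` B'"] finA' AB(2) by (simp add: A2_def)
    qed
    then have "card A2 + card B2 = card A + card B" using AB(5) by (simp add: card_image)
    moreover have "A2 + B2 \<subseteq> A' + B'"
    proof
      fix z assume "z \<in> A2 + B2"
      then obtain u w where uw: "u \<in> A2" "w \<in> B2" "z = u + w" by (auto elim: set_plus_elim)
      show "z \<in> A' + B'"
      proof (cases "u \<in> A'")
        case True
        then show ?thesis using uw by (auto simp: B2_def)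
      next
        case False
        then obtain y where y: "y \<in> B'" "u = y + e" using uw by (auto simp: A2_def)
        then have "z = (w + e) + y" using uw by (simp add: add_ac)
        moreover have "w + e \<in> A'" using uw by (simp add: B2_def)
        ultimately show ?thesis using y by blast
      qed
    qed
    moreover have "b \<in> B2" using AB(3) a by (simp add: B2_def e_def)
    ultimately have "P (A2, B2)" using AB by (auto simp: P_def A2_def B2_def)
    then have "card A2 \<le> card A'" using p(2) by (fastforce simp: q)
    moreover have "A' \<subseteq> A2" "finite A2" using finA' AB(2) by (auto simp: A2_def)
    ultimately have "A2 = A'" using card_seteq by blast
    then have "c + e \<in> A'" using c by (auto simp: A2_def)
    then show ?thesis by (simp add: e_def algebra_simps)
  qed
  define C where "C = (\<lambda>a. a + b) ` A'"
  have "(\<lambda>c. c - b) ` B' \<subseteq> stab C"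
  proof clarify
    fix c assume "c \<in> B'"
    show "c - b \<in> stab C"
    proof (rule stabI)
      fix z assume "z \<in> C"
      then obtain a where a: "a \<in> A'" "z = a + b" by (auto simp: C_def)
      have "a + (c - b) \<in> A'" using step \<open>c \<in> B'\<close> a by simp
      moreover have "z + (c - b) = (a + (c - b)) + b" using a by (simp add: add_ac)
      ultimately show "z + (c - b) \<in> C" unfolding C_def by blast
    qed (simp add: C_def finA')
  qed
  moreover have "finite C" "C \<noteq> {}" using finA' AB(1) ne by (auto simp: C_def)
  ultimately have "card ((\<lambda>c. c - b) ` B') \<le> card (stab C)" by (intro card_mono finite_stab)
  moreover have "card ((\<lambda>c. c - b) ` B') = card B'" "card C = card A'"
    by (auto simp: C_def intro!: card_image inj_onI)
  ultimately have "card A + card B \<le> card C + card (stab C)" using AB(5) by simp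
  moreover have "(\<lambda>a. a + b) ` A \<subseteq> C" "C \<subseteq> A + B" using AB by (auto simp: C_def)
  ultimately show ?thesis by (rule that [rotated 2])
qed

text \<open>The sets \<open>C b\<close> obtained from Dyson transforms cover \<open>A + B\<close>,
  as \<open>C b\<close> contains \<open>A + b\<close>. They share one lower bound, which survives
  unions.\<close>

lemma kneser_weak:
  fixes A B :: "'a::ab_group_add set"
  assumes fin: "finite A" "finite B" and ne: "A \<noteq> {}" "B \<noteq> {}"
  shows "card A + card B \<le> card (A + B) + card (stab (A + B))"
proof -
  have "\<exists>C. (\<lambda>a. a + b) ` A \<subseteq> C \<and> C \<subseteq> A + B \<and> card A + card B \<le> card C + card (stab C)"
    if "b \<in> B" for b
    using dyson_transform_stab [OF fin ne(1) that] by metis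
  then obtain C where C: "\<And>b. b \<in> B \<Longrightarrow> (\<lambda>a. a + b) ` A \<subseteq> C b \<and> C b \<subseteq> A + B
      \<and> card A + card B \<le> card (C b) + card (stab (C b))"
    by metis
  have "\<Union>(C ` B) = A + B"
    using C by (fastforce elim!: set_plus_elim)
  moreover have "card A + card B \<le> card (\<Union>(C ` B)) + card (stab (\<Union>(C ` B)))"
  proof (rule card_Union_stab)
    fix X assume "X \<in> C ` B"
    then obtain b where "b \<in> B" "X = C b" by blast
    then show "finite X \<and> X \<noteq> {} \<and> card A + card B \<le> card X + card (stab X)"
      using C [of b] ne(1) finite_set_plus [OF fin] by (metis finite_subset image_is_empty subset_empty)
  qed (use assms in auto)
  ultimately show ?thesis by simp
qed

text \<open>Enlarging \<open>A\<close> and \<open>B\<close> to \<open>A + H\<close> and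
  \<open>B + H\<close> changes neither the sumset nor its stabilizer, so the weak form for the
  enlarged sets suffices.\<close>

theorem kneser:
  fixes A B :: "'a::ab_group_add set"
  assumes fin: "finite A" "finite B" and ne: "A \<noteq> {}" "B \<noteq> {}" and H: "H = stab (A + B)"
  shows "card (A + H) + card (B + H) \<le> card (A + B) + card H"
proof -
  have finH: "finite H" using assms finite_stab finite_set_plus
    by (metis all_not_in_conv set_plus_intro)
  have "(A + H) + (B + H) = (A + B) + (H + H)" by (simp add: add_ac)
  also have "\<dots> = A + B" by (simp add: H)
  finally have eq: "(A + H) + (B + H) = A + B" .
  have "0 \<in> H" by (simp add: H)
  then show ?thesis
    using kneser_weak [of "A + H" "B + H"] fin ne finH unfolding eq H [symmetric]
    by (metis empty_iff equals0I finite_set_plus set_plus_intro)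
qed

section \<open>Kneser's theorem for several summands\<close>

lemma finite_sum_sets: "(\<And>i. i \<in> I \<Longrightarrow> finite (A i)) \<Longrightarrow> finite (\<Sum>i\<in>I. A i :: 'a::comm_monoid_add set)"
  by (induction I rule: infinite_finite_induct) (auto simp: finite_set_plus)

lemma sum_sets_nonempty: "(\<And>i. i \<in> I \<Longrightarrow> A i \<noteq> {}) \<Longrightarrow> (\<Sum>i\<in>I. A i :: 'a::comm_monoid_add set) \<noteq> {}"
  by (induction I rule: infinite_finite_induct) (auto simp: set_plus_def)

text \<open>The induction hypothesis is applied to the sets \<open>A i + H\<close> rather than
  \<open>A i\<close>: the stabilizer of the shorter sum \<open>S\<close> may be smaller than
  \<open>H\<close>, but that of \<open>S + H\<close> is exactly \<open>H\<close>.\<close>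

lemma kneser_sum:
  fixes A :: "'b \<Rightarrow> 'a::ab_group_add set"
  assumes "finite I" "I \<noteq> {}" "\<And>i. i \<in> I \<Longrightarrow> finite (A i) \<and> A i \<noteq> {}" "H = stab (\<Sum>i\<in>I. A i)"
  shows "(\<Sum>i\<in>I. card (A i + H)) + card H \<le> card (\<Sum>i\<in>I. A i) + card I * card H"
  using assms
proof (induction I arbitrary: A H rule: finite_ne_induct)
  case (singleton i)
  then show ?case by simp
next
  case (insert t I)
  define S where "S = (\<Sum>i\<in>I. A i)"
  have T: "(\<Sum>i\<in>insert t I. A i) = A t + S" using insert by (simp add: S_def)
  have H: "H = stab (A t + S)" using insert.prems T by simp
  have finS: "finite S" "S \<noteq> {}"
    using insert unfolding S_def by (auto intro!: finite_sum_sets sum_sets_nonempty)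
  have finT: "finite (A t)" "A t \<noteq> {}" using insert by auto
  have finH: "finite H" unfolding H using finS finT
    by (metis empty_iff equals0I finite_set_plus finite_stab set_plus_intro)
  have "0 \<in> H" by (simp add: H)
  have HH: "H + H = H" by (simp add: H)
  have SH: "(\<Sum>i\<in>I. A i + H) = S + H"
  proof -
    have "J \<noteq> {} \<Longrightarrow> (\<Sum>i\<in>J. H) = H" if "finite J" for J :: "'b set"
      using that by (induction J rule: finite_induct) (metis HH add.right_neutral sum.empty sum.insert)+
    then show ?thesis using insert by (simp add: sum.distrib S_def)
  qed
  have stabSH: "stab (S + H) = H"
  proof
    have "A t + S + H = A t + S" by (simp add: H)
    then have "stab (S + H) \<subseteq> stab (A t + S)"
      using stab_mono_plus [of "S + H" "A t"] finS finT finH finite_set_plus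
      by (metis add.assoc add.commute)
    then show "stab (S + H) \<subseteq> H" by (simp add: H)
    have "H \<subseteq> stab H" using HH by (auto intro!: stabI finH)
    also have "\<dots> \<subseteq> stab (S + H)" using stab_mono_plus [of H S] finS finH by (simp add: add.commute)
    finally show "H \<subseteq> stab (S + H)" .
  qed
  have IH: "(\<Sum>i\<in>I. card (A i + H)) + card H \<le> card (S + H) + card I * card H"
    using insert.IH [of "\<lambda>i. A i + H" H] insert.prems(1) finH \<open>0 \<in> H\<close>
    unfolding SH stabSH add.assoc HH by (auto simp: finite_set_plus)
  have "card (A t + H) + card (S + H) \<le> card (A t + S) + card H"
    using kneser [OF finT(1) finS(1) finT(2) finS(2) H] .
  then show ?case using IH insert.hyps T by (simp add: algebra_simps)
qed

section \<open>Kneser's theorem for residues\<close>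

text \<open>
  All the groups of residues modulo \<open>l\<close> embed into \<open>\<real>/\<int>\<close>, which has the advantage of being a type.
\<close>

quotient_type circle = real / "\<lambda>x y. x - y \<in> \<int>"
proof (rule equivpI)
  show "reflp (\<lambda>x y :: real. x - y \<in> \<int>)" by (simp add: reflp_def)
  show "symp (\<lambda>x y :: real. x - y \<in> \<int>)"
  proof (rule sympI)
    fix x y :: real assume "x - y \<in> \<int>"
    then have "- (x - y) \<in> \<int>" by (rule Ints_minus)
    then show "y - x \<in> \<int>" by simp
  qed
  show "transp (\<lambda>x y :: real. x - y \<in> \<int>)"
  proof (rule transpI)
    fix x y z :: real assume "x - y \<in> \<int>" "y - z \<in> \<int>"
    then have "(x - y) + (y - z) \<in> \<int>" by (rule Ints_add)
    then show "x - z \<in> \<int>" by simp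
  qed
qed

instantiation circle :: ab_group_add
begin

lift_definition zero_circle :: circle is 0 .

lift_definition plus_circle :: "circle \<Rightarrow> circle \<Rightarrow> circle" is "(+)"
  by (metis Ints_add add_diff_add)

lift_definition uminus_circle :: "circle \<Rightarrow> circle" is uminus
proof -
  fix x y :: real assume "x - y \<in> \<int>"
  then have "- (x - y) \<in> \<int>" by (rule Ints_minus)
  then show "- x - - y \<in> \<int>" by simp
qed

lift_definition minus_circle :: "circle \<Rightarrow> circle \<Rightarrow> circle" is "(-)"
proof -
  fix x x' y y' :: real assume "x - x' \<in> \<int>" "y - y' \<in> \<int>"
  then have "(x - x') - (y - y') \<in> \<int>" by (rule Ints_diff)
  then show "(x - y) - (x' - y') \<in> \<int>" by (simp add: algebra_simps)
qed

instance
  by standard (transfer; simp)+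

end

definition residue_embedding :: "int \<Rightarrow> int \<Rightarrow> circle" where
  "residue_embedding l x = abs_circle (real_of_int x / real_of_int l)"

lemma residue_embedding_add: "residue_embedding l (x + y) = residue_embedding l x + residue_embedding l y"
  by (simp add: residue_embedding_def plus_circle.abs_eq add_divide_distrib)

lemma residue_embedding_diff: "residue_embedding l (x - y) = residue_embedding l x - residue_embedding l y"
  by (simp add: residue_embedding_def minus_circle.abs_eq diff_divide_distrib)

lemma residue_embedding_eq_0_iff:
  assumes "l > 0"
  shows "residue_embedding l x = 0 \<longleftrightarrow> l dvd x"
proof -
  have "residue_embedding l x = 0 \<longleftrightarrow> real_of_int x / real_of_int l \<in> \<int>"
    by (simp add: residue_embedding_def zero_circle_def circle.abs_eq_iff)
  also have "\<dots> \<longleftrightarrow> (\<exists>k. x = l * k)"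
  proof
    assume "real_of_int x / real_of_int l \<in> \<int>"
    then obtain k where "real_of_int x / real_of_int l = real_of_int k" by (auto elim: Ints_cases)
    then have "real_of_int x = real_of_int (l * k)" using assms by (simp add: field_simps)
    then show "\<exists>k. x = l * k" by (metis of_int_eq_iff)
  qed (use assms in auto)
  finally show ?thesis by (simp add: dvd_def)
qed

lemma int_subgroup_multiples:
  fixes P :: "int set"
  assumes l: "l \<in> P" "l > 0" and diff: "\<And>x y. x \<in> P \<Longrightarrow> y \<in> P \<Longrightarrow> x - y \<in> P"
  obtains d where "d > 0" "\<And>z. z \<in> P \<longleftrightarrow> d dvd z"
proof -
  have z: "0 \<in> P" using diff [OF l(1) l(1)] by simp
  have neg: "- x \<in> P" if "x \<in> P" for x using diff [OF z that] by simp
  have add: "x + y \<in> P" if "x \<in> P" "y \<in> P" for x y using diff [OF that(1) neg [OF that(2)]] by simp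
  define m where "m = (LEAST m. m > 0 \<and> int m \<in> P)"
  have ex: "nat l > 0 \<and> int (nat l) \<in> P" using l by simp
  have m: "m > 0" "int m \<in> P" using LeastI [of "\<lambda>m. m > 0 \<and> int m \<in> P", OF ex] by (auto simp: m_def)
  have least: "m \<le> k" if "k > 0" "int k \<in> P" for k
    unfolding m_def using that by (intro Least_le) auto
  have mult: "int m * k \<in> P" for k
    by (induction k rule: int_induct [of _ 0]) (auto simp: z algebra_simps intro: add diff m)
  have "z \<in> P \<longleftrightarrow> int m dvd z" for z
  proof
    assume "z \<in> P"
    then have "z - int m * (z div int m) \<in> P" using diff mult by blast
    then have "z mod int m \<in> P" by (simp add: minus_mult_div_eq_mod)
    moreover have "0 \<le> z mod int m" "z mod int m < int m" using m by auto
    ultimately show "int m dvd z"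
      using least [of "nat (z mod int m)"] by (cases "z mod int m = 0") auto
  qed (use mult in \<open>auto simp: dvd_def\<close>)
  then show ?thesis using that [of "int m"] m by auto
qed

lemma image_sum_sets:
  fixes f :: "'a::comm_monoid_add \<Rightarrow> 'b::comm_monoid_add"
  assumes "f 0 = 0" "\<And>x y. f (x + y) = f x + f y" "finite I"
  shows "f ` (\<Sum>i\<in>I. A i) = (\<Sum>i\<in>I. f ` A i)"
  using assms(3)
proof (induction I rule: finite_induct)
  case (insert t I)
  have "f ` (A t + S) = f ` A t + f ` S" for S
    by (force simp: assms set_plus_def)
  then show ?case using insert by simp
qed (simp add: set_zero assms)

text \<open>The integers mapped into the stabilizer \<open>H\<close> form a subgroup containing
  \<open>l\<close>, hence consist of the multiples of a divisor \<open>d\<close>. Cosets of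
  \<open>H\<close> correspond to residues modulo \<open>d\<close>, and Kneser's inequality is
  divided by \<open>card H\<close>.\<close>

lemma kneser_mod:
  fixes A :: "'b \<Rightarrow> int set"
  assumes I: "finite I" "I \<noteq> {}" and A: "\<And>i. i \<in> I \<Longrightarrow> finite (A i) \<and> A i \<noteq> {}"
    and l: "l > 0" and T: "T = (\<Sum>i\<in>I. A i)"
  obtains d where "d > 0" "d dvd l"
    "\<And>x z. x \<in> T \<Longrightarrow> z mod d = x mod d \<Longrightarrow> \<exists>y\<in>T. y mod l = z mod l"
    "(\<Sum>i\<in>I. card ((\<lambda>x. x mod d) ` A i)) + 1 \<le> card ((\<lambda>x. x mod d) ` T) + card I"
proof -
  let ?f = "residue_embedding l"
  have f0: "?f 0 = 0" by (simp add: residue_embedding_eq_0_iff l)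
  have feq: "?f x = ?f y \<longleftrightarrow> x mod l = y mod l" for x y
    using residue_embedding_eq_0_iff [OF l, of "x - y"]
    by (simp add: residue_embedding_diff mod_eq_dvd_iff)
  have fT: "?f ` T = (\<Sum>i\<in>I. ?f ` A i)"
    unfolding T by (rule image_sum_sets) (auto simp: f0 residue_embedding_add I)
  define H where "H = stab (?f ` T)"
  have finT: "finite T" "T \<noteq> {}" unfolding T using A finite_sum_sets sum_sets_nonempty by metis+
  have finH: "finite H" "0 \<in> H" unfolding H_def using finT by (auto intro: finite_stab)
  define P where "P = {z. ?f z \<in> H}"
  have "l \<in> P" using residue_embedding_eq_0_iff [OF l, of l] finH by (simp add: P_def)
  moreover have "x - y \<in> P" if "x \<in> P" "y \<in> P" for x y
    using that by (simp add: P_def residue_embedding_diff H_def stab_diff)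
  ultimately obtain d where d: "d > 0" "\<And>z. z \<in> P \<longleftrightarrow> d dvd z"
    using int_subgroup_multiples [of l P] l by metis
  have "d dvd l" using d \<open>l \<in> P\<close> by blast
  have period: "\<exists>y\<in>T. y mod l = z mod l" if "x \<in> T" "z mod d = x mod d" for x z
  proof -
    have "z - x \<in> P" using that d by (simp add: mod_eq_dvd_iff)
    then have "?f (z - x) \<in> H" by (simp add: P_def)
    then have "?f x + ?f (z - x) \<in> ?f ` T" using that by (simp add: H_def stabD)
    then have "?f z \<in> ?f ` T" by (simp add: residue_embedding_add [symmetric])
    then show ?thesis using feq by force
  qed
  \<comment> \<open>Cosets of \<open>?f r\<close> and \<open>?f s\<close> coincide if
    \<open>r\<close> and \<open>s\<close> are congruent modulo \<open>d\<close> and are disjoint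
    otherwise; so there is one coset per residue of \<open>X\<close>.\<close>
  have cardH: "card (?f ` X + H) = card ((\<lambda>x. x mod d) ` X) * card H" if "finite X" for X
  proof -
    have "?f ` X + H = (\<Union>r\<in>(\<lambda>x. x mod d) ` X. (+) (?f r) ` H)"
    proof -
      have "(+) (?f x) ` H = (+) (?f (x mod d)) ` H" for x
      proof -
        have *: "(+) (?f x) ` H \<subseteq> (+) (?f y) ` H" if "d dvd x - y" for x y
        proof clarify
          fix h assume "h \<in> H"
          have "?f (x - y) \<in> H" using that d by (simp add: P_def)
          then have "?f (x - y) + h \<in> H" using \<open>h \<in> H\<close> by (simp add: H_def stab_add)
          moreover have "?f x + h = ?f y + (?f (x - y) + h)" by (simp add: residue_embedding_diff)
          ultimately show "?f x + h \<in> (+) (?f y) ` H" by blast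
        qed
        show ?thesis using * [of x "x mod d"] * [of "x mod d" x]
          by (metis dvd_minus_mod dvd_diff_commute subset_antisym)
      qed
      then show ?thesis by (auto simp: set_plus_def)
    qed
    also have "card \<dots> = (\<Sum>r\<in>(\<lambda>x. x mod d) ` X. card ((+) (?f r) ` H))"
    proof (rule card_UN_disjoint)
      show "\<forall>r\<in>(\<lambda>x. x mod d) ` X. \<forall>s\<in>(\<lambda>x. x mod d) ` X. r \<noteq> s \<longrightarrow> (+) (?f r) ` H \<inter> (+) (?f s) ` H = {}"
      proof (intro ballI impI equals0I)
        fix r s w assume rs: "r \<in> (\<lambda>x. x mod d) ` X" "s \<in> (\<lambda>x. x mod d) ` X" "r \<noteq> s"
          and "w \<in> (+) (?f r) ` H \<inter> (+) (?f s) ` H"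
        then obtain g h where "g \<in> H" "h \<in> H" "?f r + g = ?f s + h" by (metis IntE imageE)
        then have "?f r - ?f s = h - g" by (simp add: algebra_simps)
        moreover have "h - g \<in> H" using \<open>g \<in> H\<close> \<open>h \<in> H\<close> by (simp add: H_def stab_diff)
        ultimately have "r - s \<in> P" by (simp add: P_def residue_embedding_diff)
        then have "d dvd r - s" using d by blast
        then have "r mod d = s mod d" by (simp add: mod_eq_dvd_iff)
        then show False using rs by auto
      qed
    qed (use that finH in auto)
    also have "\<dots> = card ((\<lambda>x. x mod d) ` X) * card H" by (simp add: card_image)
    finally show ?thesis .
  qed
  have Hpos: "card H > 0" using finH by (auto simp: card_gt_0_iff)
  have "?f ` T + H = ?f ` T" by (simp add: H_def)
  then have cT: "card (?f ` T) = card ((\<lambda>x. x mod d) ` T) * card H"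
    using cardH [OF finT(1)] by simp
  have "(\<Sum>i\<in>I. card (?f ` A i + H)) + card H \<le> card (?f ` T) + card I * card H"
    unfolding fT by (rule kneser_sum) (use I A H_def fT in auto)
  moreover have "(\<Sum>i\<in>I. card (?f ` A i + H)) = (\<Sum>i\<in>I. card ((\<lambda>x. x mod d) ` A i)) * card H"
    using A by (simp add: cardH sum_distrib_right)
  ultimately have "((\<Sum>i\<in>I. card ((\<lambda>x. x mod d) ` A i)) + 1) * card H
      \<le> (card ((\<lambda>x. x mod d) ` T) + card I) * card H"
    by (simp add: cT algebra_simps)
  then have "(\<Sum>i\<in>I. card ((\<lambda>x. x mod d) ` A i)) + 1 \<le> card ((\<lambda>x. x mod d) ` T) + card I"
    using Hpos by (simp only: mult_le_cancel2)
  then show ?thesis using that d(1) \<open>d dvd l\<close> period by blast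
qed

section \<open>Growth of sumsets of integers\<close>

text \<open>The translates \<open>X + Min Y\<close> and \<open>Max X + Y\<close> lie in the sumset
  and can share only \<open>Max X + Min Y\<close>.\<close>

lemma card_plus_int_sets:
  fixes X Y :: "int set"
  assumes "finite X" "X \<noteq> {}" "finite Y" "Y \<noteq> {}"
  shows "card X + card Y \<le> card (X + Y) + 1"
proof -
  let ?P = "(\<lambda>x. x + Min Y) ` X" and ?Q = "(\<lambda>y. Max X + y) ` Y"
  have sub: "?P \<inter> ?Q \<subseteq> {Max X + Min Y}"
  proof
    fix z assume "z \<in> ?P \<inter> ?Q"
    then obtain x y where "x \<in> X" "y \<in> Y" "z = x + Min Y" "z = Max X + y" by blast
    moreover from this have "x \<le> Max X" "Min Y \<le> y" using assms by auto
    ultimately show "z \<in> {Max X + Min Y}" by simp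
  qed
  have "card X + card Y = card ?P + card ?Q" by (simp add: card_image)
  also have "\<dots> = card (?P \<union> ?Q) + card (?P \<inter> ?Q)" using assms by (intro card_Un_Int) auto
  also have "card (?P \<inter> ?Q) \<le> 1" using card_mono [OF _ sub] by simp
  also have "card (?P \<union> ?Q) \<le> card (X + Y)"
    using assms by (intro card_mono finite_set_plus Un_least image_subsetI set_plus_intro) auto
  finally show ?thesis by simp
qed

lemma card_sum_int_sets:
  fixes A :: "'b \<Rightarrow> int set"
  assumes "finite I" "\<And>i. i \<in> I \<Longrightarrow> finite (A i) \<and> A i \<noteq> {}"
  shows "(\<Sum>i\<in>I. card (A i)) + 1 \<le> card (\<Sum>i\<in>I. A i) + card I"
  using assms
proof (induction I rule: finite_induct)
  case (insert t I)
  have "finite (\<Sum>i\<in>I. A i)" "(\<Sum>i\<in>I. A i) \<noteq> {}"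
    using insert.prems finite_sum_sets sum_sets_nonempty by (metis insertI2)+
  then have "card (A t) + card (\<Sum>i\<in>I. A i) \<le> card (A t + (\<Sum>i\<in>I. A i)) + 1"
    using insert.prems by (intro card_plus_int_sets) auto
  then show ?case using insert by simp
qed (simp add: set_zero)

section \<open>Residue classes and the gain from one more summand\<close>

lemma residues_closed_under_generators:
  fixes S A :: "int set"
  assumes d: "d > 0" and S: "S \<noteq> {}"
    and closed: "\<And>x a. x \<in> S \<Longrightarrow> a \<in> A \<Longrightarrow> (x + a) mod d \<in> (\<lambda>x. x mod d) ` S"
    and gen: "\<And>e. e > 1 \<Longrightarrow> \<exists>a\<in>A. \<not> e dvd a"
  shows "{0..<d} \<subseteq> (\<lambda>x. x mod d) ` S"
proof -
  \<comment> \<open>These shifts form a subgroup of the integers that contains \<open>A\<close>;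
    since no \<open>e > 1\<close> divides all of \<open>A\<close>, it contains every
    integer.\<close>
  define P where "P = {z. \<forall>x\<in>S. (x + z) mod d \<in> (\<lambda>x. x mod d) ` S}"
  have zero: "0 \<in> P" by (simp add: P_def)
  have add: "y + z \<in> P" if "y \<in> P" "z \<in> P" for y z
    unfolding P_def
  proof clarify
    fix x assume "x \<in> S"
    then have "(x + y) mod d \<in> (\<lambda>x. x mod d) ` S" using that by (simp add: P_def)
    then obtain x' where x': "x' \<in> S" "(x + y) mod d = x' mod d" by blast
    have "(x + (y + z)) mod d = (x' + z) mod d" using x'(2) by (metis add.assoc mod_add_left_eq)
    then show "(x + (y + z)) mod d \<in> (\<lambda>x. x mod d) ` S" using that x' by (simp add: P_def)
  qed
  have mult: "int k * z \<in> P" if "z \<in> P" for k z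
    by (induction k) (auto simp: zero that algebra_simps intro: add)
  have neg: "- z \<in> P" if "z \<in> P" for z
  proof -
    \<comment> \<open>Modulo \<open>d\<close>, negation is multiplication by the natural number
      \<open>d - 1\<close>, so closure under addition yields inverses.\<close>
    have "(x + - z) mod d = (x + int (nat (d - 1)) * z) mod d" for x
    proof -
      have "x + int (nat (d - 1)) * z = x + - z + z * d" using d by (simp add: algebra_simps)
      then show ?thesis by (metis mod_mult_self1)
    qed
    then show ?thesis using mult [OF that, of "nat (d - 1)"] by (simp only: P_def mem_Collect_eq)
  qed
  have "d \<in> P" by (auto simp: P_def)
  moreover have "y - z \<in> P" if "y \<in> P" "z \<in> P" for y z
    using add [OF that(1) neg [OF that(2)]] by simp
  ultimately obtain e where e: "e > 0" "\<And>z. z \<in> P \<longleftrightarrow> e dvd z"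
    using int_subgroup_multiples [of d P] d by metis
  have "A \<subseteq> P" using closed by (auto simp: P_def)
  then have "e = 1" using gen [of e] e by force
  then have P: "z \<in> P" for z using e by simp
  obtain x where "x \<in> S" using S by blast
  show ?thesis
  proof
    fix r assume "r \<in> {0..<d}"
    then have "r = (x + (r - x)) mod d" by simp
    then show "r \<in> (\<lambda>x. x mod d) ` S" using P [of "r - x"] \<open>x \<in> S\<close> unfolding P_def by auto
  qed
qed

lemma card_residue_class_le:
  fixes d q :: int
  assumes "d > 0" "q \<ge> 0"
  shows "finite {x \<in> {0..<d * q}. x mod d = s}" "card {x \<in> {0..<d * q}. x mod d = s} \<le> nat q"
proof -
  show "finite {x \<in> {0..<d * q}. x mod d = s}" by (rule finite_subset [of _ "{0..<d * q}"]) auto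
  have "{x \<in> {0..<d * q}. x mod d = s} \<subseteq> (\<lambda>j. s + j * d) ` {0..<q}"
  proof
    fix x assume x: "x \<in> {x \<in> {0..<d * q}. x mod d = s}"
    then have "x = s + (x div d) * d" by auto
    moreover have "0 \<le> x div d" using x assms by (simp add: pos_imp_zdiv_nonneg_iff)
    moreover have "x div d < q"
    proof (rule ccontr)
      assume "\<not> x div d < q"
      then have "d * q \<le> d * (x div d)" using assms by simp
      also have "\<dots> \<le> x"
        using assms mult_div_mod_eq [of d x] pos_mod_sign [of d x] by linarith
      finally show False using x by simp
    qed
    ultimately show "x \<in> (\<lambda>j. s + j * d) ` {0..<q}" by auto
  qed
  then have "card {x \<in> {0..<d * q}. x mod d = s} \<le> card ((\<lambda>j. s + j * d) ` {0..<q})"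
    by (intro card_mono) auto
  also have "\<dots> \<le> nat q" using card_image_le [of "{0..<q}" "\<lambda>j. s + j * d"] by simp
  finally show "card {x \<in> {0..<d * q}. x mod d = s} \<le> nat q" .
qed

text \<open>Each class other than that of \<open>a\<close> has at most \<open>q\<close> elements in
  \<open>{0..<d * q}\<close>; the final \<open>1\<close> pays for the endpoint
  \<open>d * q\<close>.\<close>

lemma card_le_residue_class:
  fixes A :: "int set"
  assumes d: "d > 0" and q: "q \<ge> 0" and A: "A \<subseteq> {0..d * q}" and a: "a \<in> A"
  shows "int (card A) \<le> int (card {x \<in> A. x mod d = a mod d})
      + q * (int (card ((\<lambda>x. x mod d) ` A)) - 1) + 1"
proof -
  define R where "R = (\<lambda>x. x mod d) ` A - {a mod d}"
  have finA: "finite A" using A finite_subset by blast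
  have finR: "finite R" using finA by (simp add: R_def)
  have "A \<subseteq> {x \<in> A. x mod d = a mod d} \<union> {d * q} \<union> (\<Union>s\<in>R. {x \<in> {0..<d * q}. x mod d = s})"
    using A by (fastforce simp: R_def)
  then have "card A \<le> card ({x \<in> A. x mod d = a mod d} \<union> {d * q} \<union> (\<Union>s\<in>R. {x \<in> {0..<d * q}. x mod d = s}))"
    using finA finR card_residue_class_le(1) [OF d q] by (intro card_mono) (simp_all add: finite_UN)
  also have "\<dots> \<le> card {x \<in> A. x mod d = a mod d} + 1 + card (\<Union>s\<in>R. {x \<in> {0..<d * q}. x mod d = s})"
    by (rule order_trans [OF card_Un_le add_mono [OF order_trans [OF card_Un_le] order_refl]]) simp
  also have "card (\<Union>s\<in>R. {x \<in> {0..<d * q}. x mod d = s}) \<le> (\<Sum>s\<in>R. card {x \<in> {0..<d * q}. x mod d = s})"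
    using finR by (rule card_UN_le)
  also have "\<dots> \<le> card R * nat q"
    using sum_bounded_above [of R "\<lambda>s. card {x \<in> {0..<d * q}. x mod d = s}" "nat q"]
      card_residue_class_le(2) [OF d q] by simp
  finally have "int (card A) \<le> int (card {x \<in> A. x mod d = a mod d} + 1 + card R * nat q)"
    by (simp only: of_nat_le_iff)
  moreover have "int (card R) = int (card ((\<lambda>x. x mod d) ` A)) - 1"
  proof -
    have "card ((\<lambda>x. x mod d) ` A) > 0" using a finA by (auto simp: card_gt_0_iff)
    then show ?thesis unfolding R_def using a by (subst card_Diff_singleton) auto
  qed
  ultimately show ?thesis using q by (simp add: mult.commute)
qed

lemma sumset_gain:
  fixes A :: "'b \<Rightarrow> int set"
  assumes I: "finite I" "t \<notin> I" and l: "l > 0"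
    and A: "\<And>i. i \<in> insert t I \<Longrightarrow> A i \<subseteq> {0..l} \<and> A i \<noteq> {}"
    and ends: "0 \<in> A t" "l \<in> A t" and gen: "\<And>e. e > 1 \<Longrightarrow> \<exists>a\<in>A t. \<not> e dvd a"
  shows "int (card (\<Sum>i\<in>I. A i)) + min l ((\<Sum>i\<in>insert t I. int (card (A i)) - 2) + 1)
    \<le> int (card (\<Sum>i\<in>insert t I. A i))"
proof -
  define J where "J = insert t I"
  define S where "S = (\<Sum>i\<in>I. A i)"
  define W where "W = (\<Sum>i\<in>J. A i)"
  have W: "W = A t + S" using I by (simp add: W_def S_def J_def)
  have J: "finite J" "J \<noteq> {}" using I by (auto simp: J_def)
  have finA: "finite (A i) \<and> A i \<noteq> {}" if "i \<in> J" for i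
    using A [of i] that finite_subset by (auto simp: J_def)
  have finS: "finite S" "S \<noteq> {}" unfolding S_def
    using finA finite_sum_sets sum_sets_nonempty by (metis J_def insertI2)+
  have finW: "finite W" unfolding W_def using finA by (intro finite_sum_sets) auto
  have SW: "S \<subseteq> W" using ends(1) unfolding W by (rule set_zero_plus2)
  define N where "N = W - S"
  have cN: "card W = card S + card N" using SW finW finS unfolding N_def
    by (metis card_Diff_subset card_mono le_add_diff_inverse)
  have finN: "finite N" using finW by (simp add: N_def)
  \<comment> \<open>The largest element of \<open>S\<close> in a class, increased by
    \<open>l\<close>, is new. If \<open>S\<close> misses the class, \<open>x\<close> itself is
    new.\<close>
  have Nl: "\<exists>y\<in>N. y mod l = x mod l" if "x \<in> W" for x
  proof (cases "\<exists>y\<in>S. y mod l = x mod l")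
    case True
    define m where "m = Max {y \<in> S. y mod l = x mod l}"
    have "m \<in> {y \<in> S. y mod l = x mod l}" unfolding m_def using True finS by (intro Max_in) auto
    then have m: "m \<in> S" "m mod l = x mod l" by auto
    have "l + m \<in> W" unfolding W using ends m by blast
    moreover have "l + m \<notin> S"
    proof
      assume "l + m \<in> S"
      then have "l + m \<in> {y \<in> S. y mod l = x mod l}" using m by simp
      then have "l + m \<le> m" unfolding m_def using finS by (intro Max_ge) auto
      then show False using l by simp
    qed
    ultimately show ?thesis using m by (intro bexI [of _ "l + m"]) (auto simp: N_def)
  next
    case False
    then show ?thesis using that by (auto simp: N_def)
  qed
  obtain d where d: "d > 0" "d dvd l"
    and period: "\<And>x z. x \<in> W \<Longrightarrow> z mod d = x mod d \<Longrightarrow> \<exists>y\<in>W. y mod l = z mod l"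
    and kn: "(\<Sum>i\<in>J. card ((\<lambda>x. x mod d) ` A i)) + 1 \<le> card ((\<lambda>x. x mod d) ` W) + card J"
    using kneser_mod [OF J finA l W_def] by metis
  obtain q where q: "l = d * q" using d by blast
  have "q > 0" using q d l by (simp add: zero_less_mult_iff)
  define Wd where "Wd = (\<lambda>x. x mod d) ` W"
  define Sd where "Sd = (\<lambda>x. x mod d) ` S"
  have modd: "y mod d = z mod d" if "y mod l = z mod l" for y z
    using that d(2) by (metis mod_mod_cancel)
  \<comment> \<open>A class modulo \<open>d\<close> consists of \<open>q\<close> classes modulo
    \<open>l\<close>. If \<open>W\<close> meets the former, it meets all of the latter, and each
    contains a new element.\<close>
  have Nr: "q \<le> int (card {x \<in> N. x mod d = r})" if r: "r \<in> Wd" for r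
  proof -
    obtain x where x: "x \<in> W" "r = x mod d" using r by (auto simp: Wd_def)
    have r: "0 \<le> r" "r < d" using x d by auto
    have "(\<lambda>j. r + j * d) ` {0..<q} \<subseteq> (\<lambda>y. y mod l) ` {x \<in> N. x mod d = r}"
    proof clarify
      fix j assume j: "j \<in> {0..<q}"
      have "(r + j * d) mod d = x mod d" using x by simp
      then obtain y where y: "y \<in> N" "y mod l = (r + j * d) mod l" using period [OF x(1)] Nl by metis
      have "y mod d = r" using modd [OF y(2)] x by simp
      have "j * d \<le> (q - 1) * d" using j d by (intro mult_right_mono) auto
      then have "r + j * d < l" using r q by (simp add: algebra_simps)
      moreover have "0 \<le> r + j * d" using r j d by simp
      ultimately have "y mod l = r + j * d" using y by simp
      then show "r + j * d \<in> (\<lambda>y. y mod l) ` {x \<in> N. x mod d = r}"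
        using y \<open>y mod d = r\<close> by (metis (mono_tags, lifting) imageI mem_Collect_eq)
    qed
    then have "card ((\<lambda>j. r + j * d) ` {0..<q}) \<le> card {x \<in> N. x mod d = r}"
      using finN by (intro surj_card_le) auto
    moreover have "card ((\<lambda>j. r + j * d) ` {0..<q}) = card {0..<q}"
      using d by (intro card_image inj_onI) auto
    ultimately show ?thesis using \<open>q > 0\<close> by simp
  qed
  have finWd: "finite Wd" using finW by (simp add: Wd_def)
  have "(\<lambda>x. x mod d) ` N = Wd"
  proof
    show "(\<lambda>x. x mod d) ` N \<subseteq> Wd" by (auto simp: N_def Wd_def)
    show "Wd \<subseteq> (\<lambda>x. x mod d) ` N" unfolding Wd_def
    proof (rule image_subsetI)
      fix x assume "x \<in> W"
      then obtain y where "y \<in> N" "y mod l = x mod l" using Nl by blast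
      then show "x mod d \<in> (\<lambda>x. x mod d) ` N" using modd by (metis imageI)
    qed
  qed
  then have cardN: "card N = (\<Sum>r\<in>Wd. card {x \<in> N. x mod d = r})"
    using sum.image_gen [OF finN, of "\<lambda>_. 1::nat" "\<lambda>x. x mod d"] by simp
  have "min l ((\<Sum>i\<in>J. int (card (A i)) - 2) + 1) \<le> int (card N)"
  proof (cases "Wd \<subseteq> Sd")
    case True
    \<comment> \<open>Here the residues of \<open>S\<close> are closed under adding elements of
      \<open>A t\<close>, so all \<open>d\<close> classes occur, with at least \<open>q\<close> new
      elements each: \<open>d * q = l\<close> in total.\<close>
    have "{0..<d} \<subseteq> Sd" unfolding Sd_def
    proof (rule residues_closed_under_generators [OF d(1) finS(2) _ gen])
      fix x a assume "x \<in> S" "a \<in> A t"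
      then have "a + x \<in> W" unfolding W by blast
      then show "(x + a) mod d \<in> (\<lambda>x. x mod d) ` S"
        using True by (auto simp: Wd_def Sd_def add.commute)
    qed
    also have "Sd \<subseteq> Wd" using SW by (auto simp: Sd_def Wd_def)
    finally have "card {0..<d} \<le> card Wd" using finWd by (intro card_mono)
    then have "d * q \<le> int (card Wd) * q" using \<open>q > 0\<close> d by simp
    also have "\<dots> \<le> (\<Sum>r\<in>Wd. int (card {x \<in> N. x mod d = r}))"
      using sum_bounded_below [of Wd q] Nr by simp
    finally show ?thesis using cardN q by simp
  next
    case False
    then obtain w where w: "w \<in> W" "w mod d \<notin> Sd" by (auto simp: Wd_def)
    then obtain a where a: "w = (\<Sum>i\<in>J. a i)" "\<And>i. i \<in> J \<Longrightarrow> a i \<in> A i"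
      unfolding W_def set_sum_alt [OF J(1)] by blast
    \<comment> \<open>Keeping only the elements congruent to the components of \<open>w\<close>
      leaves sums in the class of \<open>w\<close>, which \<open>S\<close> misses; so all of them
      are new.\<close>
    define A' where "A' i = {x \<in> A i. x mod d = a i mod d}" for i
    have "(\<Sum>i\<in>J. A' i) \<subseteq> {x \<in> N. x mod d = w mod d}"
    proof
      fix z assume "z \<in> (\<Sum>i\<in>J. A' i)"
      then obtain s where s: "z = (\<Sum>i\<in>J. s i)" "\<And>i. i \<in> J \<Longrightarrow> s i \<in> A' i"
        unfolding set_sum_alt [OF J(1)] by blast
      have "z mod d = (\<Sum>i\<in>J. s i mod d) mod d" by (simp add: s(1) mod_sum_eq)
      also have "(\<Sum>i\<in>J. s i mod d) = (\<Sum>i\<in>J. a i mod d)"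
        using s(2) by (intro sum.cong) (auto simp: A'_def)
      also have "\<dots> mod d = w mod d" by (simp add: a(1) mod_sum_eq)
      finally have zw: "z mod d = w mod d" .
      moreover have "z \<in> W" unfolding W_def set_sum_alt [OF J(1)] using s by (auto simp: A'_def)
      moreover have "z \<notin> S" using zw w by (metis Sd_def imageI)
      ultimately show "z \<in> {x \<in> N. x mod d = w mod d}" by (simp add: N_def)
    qed
    then have "card (\<Sum>i\<in>J. A' i) \<le> card {x \<in> N. x mod d = w mod d}"
      using finN by (intro card_mono) auto
    moreover have "(\<Sum>i\<in>J. card (A' i)) + 1 \<le> card (\<Sum>i\<in>J. A' i) + card J"
      using finA a by (intro card_sum_int_sets J) (auto simp: A'_def)
    ultimately have new: "(\<Sum>i\<in>J. int (card (A' i))) + 1 - int (card J) \<le> int (card {x \<in> N. x mod d = w mod d})"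
      by (simp flip: of_nat_sum)
    have wWd: "w mod d \<in> Wd" using w by (simp add: Wd_def)
    have "int (card N) = int (card {x \<in> N. x mod d = w mod d}) + (\<Sum>r\<in>Wd - {w mod d}. int (card {x \<in> N. x mod d = r}))"
      unfolding cardN using sum.remove [OF finWd wWd] by simp
    moreover have "(int (card Wd) - 1) * q \<le> (\<Sum>r\<in>Wd - {w mod d}. int (card {x \<in> N. x mod d = r}))"
    proof -
      have "card Wd > 0" using wWd finWd by (auto simp: card_gt_0_iff)
      then show ?thesis
        using sum_bounded_below [of "Wd - {w mod d}" q] Nr wWd finWd by simp
    qed
    moreover have "((\<Sum>i\<in>J. int (card ((\<lambda>x. x mod d) ` A i))) - int (card J)) * q \<le> (int (card Wd) - 1) * q"
      using kn \<open>q > 0\<close> unfolding Wd_def [symmetric] by (intro mult_right_mono) (simp_all flip: of_nat_sum)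
    moreover have "(\<Sum>i\<in>J. int (card (A i))) \<le> (\<Sum>i\<in>J. int (card (A' i))
        + q * (int (card ((\<lambda>x. x mod d) ` A i)) - 1) + 1)"
      unfolding A'_def using A a(2) d \<open>q > 0\<close> q
      by (intro sum_mono card_le_residue_class) (auto simp: J_def)
    \<comment> \<open>Passing from \<open>A i\<close> to \<open>A' i\<close> costs at most
      \<open>q\<close> per other residue, plus \<open>1\<close>. By Kneser's bound the multiples of
      \<open>q\<close> add up to at most \<open>(card Wd - 1) * q\<close>, which the other classes
      of \<open>N\<close> return.\<close>
    ultimately have "(\<Sum>i\<in>J. int (card (A i)) - 2) + 1 \<le> int (card N)"
      using new by (simp add: sum.distrib sum_subtractf sum_distrib_left [symmetric] algebra_simps)
    then show ?thesis by simp
  qed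
  then show ?thesis using cN by (simp add: J_def S_def W_def)
qed

text \<open>As \<open>L\<close> increases, the sets already summed fit into \<open>{0..L h}\<close>,
  and the next one can serve as \<open>A t\<close> in \<open>sumset_gain\<close>. The leading
  \<open>1\<close> counts the empty sum \<open>{0}\<close>.\<close>

lemma sumset_chain:
  fixes B :: "nat \<Rightarrow> int set" and L :: "nat \<Rightarrow> int"
  assumes "\<And>i. i < h \<Longrightarrow> B i \<subseteq> {0..L i} \<and> 0 \<in> B i \<and> L i \<in> B i \<and> L i > 0 \<and> n \<le> int (card (B i))"
    and "\<And>i e. i < h \<Longrightarrow> e > 1 \<Longrightarrow> \<exists>a\<in>B i. \<not> e dvd a"
    and "\<And>i j. i \<le> j \<Longrightarrow> j < h \<Longrightarrow> L i \<le> L j"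
  shows "1 + (\<Sum>j<h. min (L j) ((int j + 1) * (n - 2) + 1)) \<le> int (card (\<Sum>i<h. B i))"
  using assms
proof (induction h)
  case (Suc h)
  have "int (card (\<Sum>i<h. B i)) + min (L h) ((\<Sum>i\<in>insert h {..<h}. int (card (B i)) - 2) + 1)
      \<le> int (card (\<Sum>i\<in>insert h {..<h}. B i))"
  proof (rule sumset_gain)
    fix i assume "i \<in> insert h {..<h}"
    then have "i < Suc h" by auto
    then show "B i \<subseteq> {0..L h} \<and> B i \<noteq> {}"
      using Suc.prems(1) [of i] Suc.prems(3) [of i h] by fastforce
  qed (use Suc.prems(1) [of h] Suc.prems(2) [of h] in auto)
  moreover have "(\<Sum>i\<in>insert h {..<h}. n - 2) \<le> (\<Sum>i\<in>insert h {..<h}. int (card (B i)) - 2)"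
    using Suc.prems(1) by (intro sum_mono) (auto simp: less_Suc_eq)
  then have "(int h + 1) * (n - 2) + 1 \<le> (\<Sum>i\<in>insert h {..<h}. int (card (B i)) - 2) + 1"
    by (simp add: algebra_simps)
  moreover have "1 + (\<Sum>j<h. min (L j) ((int j + 1) * (n - 2) + 1)) \<le> int (card (\<Sum>i<h. B i))"
    by (rule Suc.IH) (use Suc.prems in auto)
  ultimately show ?case unfolding lessThan_Suc [symmetric] sum.lessThan_Suc by linarith
qed (simp add: set_zero)

section \<open>Blocks of consecutive integers\<close>

text \<open>If \<open>g\<close> is missed, then \<open>X\<close> and \<open>g - Y\<close> are
  disjoint. For \<open>g\<close> in the stated range both lie in an interval with at most
  \<open>q + s + 1\<close> elements, which is too small.\<close>

lemma interval_subset_plus: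
  fixes X Y :: "int set"
  assumes X: "X \<subseteq> {0..p}" and Y: "Y \<subseteq> {0..q}" and "p \<le> q" "0 \<le> q"
    and s: "q + 2 + s \<le> int (card X) + int (card Y)" and "0 \<le> s"
  shows "{p - s..q + s} \<subseteq> X + Y"
proof (rule subsetI, rule ccontr)
  fix g assume g: "g \<in> {p - s..q + s}" and "g \<notin> X + Y"
  define Z where "Z = (\<lambda>y. g - y) ` Y"
  have fin: "finite X" "finite Y" using X Y finite_subset by auto
  have "X \<inter> Z = {}"
  proof (rule equals0I)
    fix x assume "x \<in> X \<inter> Z"
    then obtain y where "x \<in> X" "y \<in> Y" "x = g - y" by (auto simp: Z_def)
    then have "g = x + y" "x \<in> X" "y \<in> Y" by auto
    then show False using \<open>g \<notin> X + Y\<close> by blast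
  qed
  then have "card (X \<union> Z) = card X + card Z" using fin by (simp add: card_Un_disjoint Z_def)
  moreover have "card Z = card Y" unfolding Z_def by (intro card_image inj_onI) auto
  moreover have "card (X \<union> Z) \<le> card {min 0 (g - q)..max p g}"
    using X Y by (intro card_mono) (fastforce simp: Z_def)+
  ultimately have "card X + card Y \<le> nat (max p g - min 0 (g - q) + 1)" by simp
  moreover have "p - s \<le> g" "g \<le> q + s" using g by auto
  ultimately show False using s assms(3,4,6) by linarith
qed

text \<open>
  Each summand is a concave function of \<open>x j\<close>, hence lies above the chord over \<open>{n - 1..M}\<close>;
  the chords have increasing slopes, so that Chebyshev's sum inequality reduces the claim to the two
  constant sequences \<open>x = n - 1\<close> and \<open>x = M\<close>.
\<close>

lemma sum_min_lower_bound:
  fixes x :: "nat \<Rightarrow> int" and n M :: int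
  assumes "n \<ge> 2" "M \<ge> n - 1" "M \<le> (int K + 1) * (n - 2) + 1"
    and "\<And>j. j < K \<Longrightarrow> n - 1 \<le> x j \<and> x j \<le> M"
    and "\<And>i j. i \<le> j \<Longrightarrow> j < K \<Longrightarrow> x i \<le> x j"
  shows "(int K + 1) * (n - 1) - M \<le> (\<Sum>j<K. 2 * min (x j) ((int j + 1) * (n - 2) + 1) - x j)"
  using assms(3-5)
proof (induction K)
  case 0
  then show ?case using assms by simp
next
  case (Suc K)
  define f where "f j = (int j + 1) * (n - 2) + 1" for j
  have fmono: "f i \<le> f j" if "i \<le> j" for i j
    using that assms(1) unfolding f_def by (intro add_mono mult_right_mono) auto
  show ?case
  proof (cases "M \<le> f K")
    case True
    \<comment> \<open>Since \<open>x K \<le> M \<le> f K\<close>, the last summand is just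
      \<open>x K \<ge> n - 1\<close>.\<close>
    have "(int K + 1) * (n - 1) - M \<le> (\<Sum>j<K. 2 * min (x j) (f j) - x j)"
      unfolding f_def by (rule Suc.IH) (use Suc.prems True in \<open>auto simp: f_def\<close>)
    moreover have "n - 1 \<le> 2 * min (x K) (f K) - x K" using Suc.prems(2) [of K] True by auto
    ultimately show ?thesis by (simp add: f_def algebra_simps)
  next
    case False
    define N where "N = int K + 1"
    define D where "D = M - (n - 1)"
    define y where "y j = x j - (n - 1)" for j
    \<comment> \<open>The chord through the values \<open>n - 1\<close> at \<open>n - 1\<close> and
      \<open>2 * f j - M\<close> at \<open>M\<close> has slope \<open>c j / D\<close>; inequalities
      are multiplied by \<open>D\<close> to stay in the integers.\<close>
    define c where "c j = 2 * f j - M - (n - 1)" for j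
    \<comment> \<open>The slack in the hypothesis on \<open>M\<close>; the bound to be proved is
      \<open>\<delta> + N\<close>.\<close>
    define \<delta> where "\<delta> = f (Suc K) - M"
    define Y where "Y = (\<Sum>j<Suc K. y j)"
    have "f 0 \<le> f K" by (rule fmono) simp
    then have D: "D > 0" using False by (simp add: D_def f_def)
    have \<delta>: "\<delta> \<ge> 0" using Suc.prems(1) by (simp add: \<delta>_def f_def)
    have y: "0 \<le> y j" "y j \<le> D" if "j < Suc K" for j
      using Suc.prems(2) [OF that] by (auto simp: y_def D_def)
    have chord: "D * (n - 1) + y j * c j \<le> D * (2 * min (x j) (f j) - x j)" if j: "j < Suc K" for j
    proof -
      have fj: "f 0 \<le> f j" "f j \<le> M" using fmono [of 0 j] fmono [of j K] j False by auto
      show ?thesis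
      proof (cases "x j \<le> f j")
        case True
        have "y j * c j \<le> y j * D" using y [OF j] fj by (intro mult_left_mono) (auto simp: c_def D_def)
        then show ?thesis using True by (simp add: y_def algebra_simps)
      next
        case False
        have "0 \<le> (D - y j) * (c j + D)"
          using y [OF j] fj by (intro mult_nonneg_nonneg) (auto simp: c_def D_def f_def)
        moreover have "2 * f j - x j = n - 1 + (c j + D - y j)" by (simp add: c_def D_def y_def)
        moreover have "2 * min (x j) (f j) - x j = 2 * f j - x j" using False by simp
        ultimately show ?thesis by (simp only:) (simp add: algebra_simps)
      qed
    qed
    \<comment> \<open>The version of Chebyshev's inequality used needs oppositely ordered sequences,
      whence the sign of \<open>c\<close>.\<close>
    have "of_nat (Suc K) * (\<Sum>j=0..<Suc K. y j * - c j) \<le> (\<Sum>j=0..<Suc K. y j) * (\<Sum>j=0..<Suc K. - c j)"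
    proof (rule Chebyshev_sum_upper)
      fix i j assume "i \<le> j" "j < Suc K"
      then show "y i \<le> y j" using Suc.prems(3) by (simp add: y_def)
      show "- c j \<le> - c i" using fmono [OF \<open>i \<le> j\<close>] by (simp add: c_def)
    qed
    then have "Y * (\<Sum>j<Suc K. c j) \<le> N * (\<Sum>j<Suc K. y j * c j)"
      by (simp only: atLeast0LessThan sum_negf mult_minus_right N_def Y_def of_nat_Suc) (simp add: add.commute)
    moreover have "(\<Sum>j<Suc K. c j) = N * (\<delta> + 2 - n)"
    proof -
      have "(\<Sum>j<h. c j) = int h * ((int h + 1) * (n - 2) + 2 - M - (n - 1))" for h
        by (induction h) (auto simp: c_def f_def algebra_simps)
      then show ?thesis by (simp only: N_def \<delta>_def f_def) (simp add: algebra_simps)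
    qed
    ultimately have "N * (Y * (\<delta> + 2 - n)) \<le> N * (\<Sum>j<Suc K. y j * c j)"
      by (simp only: mult.left_commute)
    then have cheb: "Y * (\<delta> + 2 - n) \<le> (\<Sum>j<Suc K. y j * c j)" by (simp add: N_def)
    have Y: "0 \<le> Y" "Y \<le> N * D"
    proof -
      show "0 \<le> Y" unfolding Y_def using y by (intro sum_nonneg) auto
      show "Y \<le> N * D" unfolding Y_def N_def
        using sum_bounded_above [of "{..<Suc K}" y D] y by (simp add: add.commute)
    qed
    \<comment> \<open>The right side is linear in \<open>Y\<close>, so its minimum over
      \<open>{0..N * D}\<close> is at an end: \<open>Y = 0\<close> means that all
      \<open>x j = n - 1\<close>, and \<open>Y = N * D\<close> that all
      \<open>x j = M\<close>.\<close>
    have "D * (\<delta> + N) \<le> N * (D * (n - 1)) + Y * (\<delta> + 2 - n)"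
    proof (cases "\<delta> + 2 - n \<ge> 0")
      case True
      have "\<delta> + N \<le> N * (n - 1)" using D by (simp add: \<delta>_def f_def N_def D_def algebra_simps)
      then have "D * (\<delta> + N) \<le> D * (N * (n - 1))" using D by (intro mult_left_mono) auto
      moreover have "0 \<le> Y * (\<delta> + 2 - n)" using True Y by simp
      ultimately show ?thesis by (simp add: algebra_simps)
    next
      case False
      then have "N * D * (\<delta> + 2 - n) \<le> Y * (\<delta> + 2 - n)" using Y by (intro mult_right_mono_neg) auto
      moreover have "0 \<le> D * ((N - 1) * \<delta>)" using D \<delta> by (simp add: N_def)
      ultimately show ?thesis by (simp add: algebra_simps)
    qed
    also have "\<dots> \<le> (\<Sum>j<Suc K. D * (n - 1) + y j * c j)"
      using cheb by (simp only: sum.distrib) (simp add: N_def algebra_simps)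
    also have "\<dots> \<le> (\<Sum>j<Suc K. D * (2 * min (x j) (f j) - x j))"
      by (intro sum_mono chord) auto
    also have "\<dots> = D * (\<Sum>j<Suc K. 2 * min (x j) (f j) - x j)" by (simp only: sum_distrib_left)
    finally have "\<delta> + N \<le> (\<Sum>j<Suc K. 2 * min (x j) (f j) - x j)" using D by (simp only: mult_le_cancel_left_pos)
    moreover have "\<delta> + N = (int (Suc K) + 1) * (n - 1) - M" by (simp add: \<delta>_def N_def f_def algebra_simps)
    ultimately show ?thesis by (simp only: f_def)
  qed
qed

section \<open>A block from the sets in even and odd positions\<close>

lemma sum_sets_subset_interval:
  fixes B :: "'b \<Rightarrow> int set"
  assumes "finite I" "\<And>i. i \<in> I \<Longrightarrow> B i \<subseteq> {0..L i}"
  shows "(\<Sum>i\<in>I. B i) \<subseteq> {0..\<Sum>i\<in>I. L i}"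
proof
  fix z assume "z \<in> (\<Sum>i\<in>I. B i)"
  then obtain s where s: "z = (\<Sum>i\<in>I. s i)" "\<And>i. i \<in> I \<Longrightarrow> s i \<in> B i"
    unfolding set_sum_alt [OF assms(1)] by blast
  have "0 \<le> s i \<and> s i \<le> L i" if "i \<in> I" for i
    using subsetD [OF assms(2) [OF that] s(2) [OF that]] by simp
  then show "z \<in> {0..\<Sum>i\<in>I. L i}" by (simp add: s(1) sum_nonneg sum_mono)
qed

lemma sum_lessThan_odd_split:
  fixes b :: "nat \<Rightarrow> 'a::comm_monoid_add"
  shows "(\<Sum>i<2 * K + 1. b i) = (\<Sum>j<K. b (2 * j + 1)) + (\<Sum>j<Suc K. b (2 * j))"
  by (induction K) (simp_all add: add_ac)

text \<open>Alternating positions keep the spans \<open>p\<close> and \<open>q\<close> of the two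
  partial sums within \<open>M\<close> of each other. Growth of sumsets bounds both cardinalities,
  \<open>sum_min_lower_bound\<close> compares them with the spans, and
  \<open>interval_subset_plus\<close> yields the block.\<close>

lemma block_in_odd_sumset:
  fixes B :: "nat \<Rightarrow> int set" and L :: "nat \<Rightarrow> int"
  assumes n: "n \<ge> 2" and M: "L (2 * K) \<le> (int K + 1) * (n - 2) + 1"
    and B: "\<And>i. i \<le> 2 * K \<Longrightarrow> B i \<subseteq> {0..L i} \<and> 0 \<in> B i \<and> L i \<in> B i \<and> n \<le> int (card (B i))"
    and gen: "\<And>i e. i \<le> 2 * K \<Longrightarrow> e > 1 \<Longrightarrow> \<exists>a\<in>B i. \<not> e dvd a"
    and mono: "\<And>i j. i \<le> j \<Longrightarrow> j \<le> 2 * K \<Longrightarrow> L i \<le> L j"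
  shows "contains_block (\<Sum>i<2 * K + 1. B i) (2 * (int K + 1) * (n - 1) - L (2 * K))"
proof -
  define M where "M = L (2 * K)"
  define f where "f j = (int j + 1) * (n - 2) + 1" for j :: nat
  have L: "n - 1 \<le> L i" "L i \<le> M" if "i \<le> 2 * K" for i
  proof -
    have "card (B i) \<le> card {0..L i}" using B [OF that] by (intro card_mono) auto
    moreover have "0 \<le> L i" using B [OF that] by auto
    ultimately show "n - 1 \<le> L i" using B [OF that] by auto
    show "L i \<le> M" using mono that by (simp add: M_def)
  qed
  define X where "X = (\<Sum>j<K. B (2 * j + 1))"
  define Y where "Y = (\<Sum>j<Suc K. B (2 * j))"
  define p where "p = (\<Sum>j<K. L (2 * j + 1))"
  define q where "q = (\<Sum>j<Suc K. L (2 * j))"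
  have X: "X \<subseteq> {0..p}" unfolding X_def p_def using B by (intro sum_sets_subset_interval) auto
  have Y: "Y \<subseteq> {0..q}" unfolding Y_def q_def using B by (intro sum_sets_subset_interval) auto
  have cX: "1 + (\<Sum>j<K. min (L (2 * j + 1)) (f j)) \<le> int (card X)"
    unfolding X_def f_def
  proof (rule sumset_chain)
    fix i assume "i < K"
    then show "B (2 * i + 1) \<subseteq> {0..L (2 * i + 1)} \<and> 0 \<in> B (2 * i + 1) \<and> L (2 * i + 1) \<in> B (2 * i + 1)
        \<and> 0 < L (2 * i + 1) \<and> n \<le> int (card (B (2 * i + 1)))"
      using B [of "2 * i + 1"] L(1) [of "2 * i + 1"] n by auto
  qed (use gen mono in auto)
  have "1 + (\<Sum>j<Suc K. min (L (2 * j)) (f j)) \<le> int (card Y)"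
    unfolding Y_def f_def
  proof (rule sumset_chain)
    fix i assume "i < Suc K"
    then show "B (2 * i) \<subseteq> {0..L (2 * i)} \<and> 0 \<in> B (2 * i) \<and> L (2 * i) \<in> B (2 * i)
        \<and> 0 < L (2 * i) \<and> n \<le> int (card (B (2 * i)))"
      using B [of "2 * i"] L(1) [of "2 * i"] n by auto
  qed (use gen mono in auto)
  \<comment> \<open>As \<open>M \<le> f K\<close>, the last and longest set contributes its full
    length \<open>M\<close>.\<close>
  then have cY: "1 + (\<Sum>j<K. min (L (2 * j)) (f j)) + M \<le> int (card Y)"
    using M by (simp add: M_def f_def min_absorb1)
  have b1: "(int K + 1) * (n - 1) - M \<le> (\<Sum>j<K. 2 * min (L (2 * j + 1)) (f j) - L (2 * j + 1))"
    unfolding f_def using n M L mono by (intro sum_min_lower_bound) (auto simp: M_def)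
  have b2: "(int K + 1) * (n - 1) - M \<le> (\<Sum>j<K. 2 * min (L (2 * j)) (f j) - L (2 * j))"
    unfolding f_def using n M L mono by (intro sum_min_lower_bound) (auto simp: M_def)
  have q: "q = (\<Sum>j<K. L (2 * j)) + M" by (simp add: q_def M_def)
  have "p \<le> q"
  proof -
    have "p \<le> (\<Sum>j<K. L (2 * Suc j))" unfolding p_def using mono by (intro sum_mono) auto
    moreover have "0 \<le> L 0" using L(1) [of 0] n by simp
    ultimately show ?thesis unfolding q_def sum.lessThan_Suc_shift by simp
  qed
  have "q - p \<le> M"
  proof -
    have "(\<Sum>j<K. L (2 * j)) \<le> p" unfolding p_def using mono by (intro sum_mono) auto
    then show ?thesis using q by simp
  qed
  \<comment> \<open>The largest surplus that \<open>interval_subset_plus\<close> admits; the block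
    \<open>{p - s..q + s}\<close> has length
    \<open>2 * card X + 2 * card Y - p - q - 4\<close>.\<close>
  define s where "s = int (card X) + int (card Y) - q - 2"
  have len: "2 * (int K + 1) * (n - 1) - M \<le> q - p + 2 * s"
    using cX cY b1 b2 unfolding s_def q p_def
    by (simp add: sum_subtractf sum_distrib_left [symmetric] algebra_simps)
  \<comment> \<open>The guaranteed length is at least \<open>M\<close>, hence at least
    \<open>q - p\<close>, which makes \<open>s\<close> nonnegative.\<close>
  have "2 * M \<le> 2 * (int K + 1) * (n - 1)"
    using M by (simp add: M_def algebra_simps)
  then have "0 \<le> s" using len \<open>q - p \<le> M\<close> by linarith
  moreover have "0 \<le> q" unfolding q_def
  proof (rule sum_nonneg)
    fix j assume "j \<in> {..<Suc K}"
    then show "0 \<le> L (2 * j)" using L(1) [of "2 * j"] n by simp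
  qed
  ultimately have "{p - s..q + s} \<subseteq> X + Y"
    using X Y \<open>p \<le> q\<close> by (intro interval_subset_plus) (auto simp: s_def)
  moreover have "{p - s..p - s + (2 * (int K + 1) * (n - 1) - M)} \<subseteq> {p - s..q + s}"
    using len by auto
  ultimately show ?thesis
    unfolding contains_block_def sum_lessThan_odd_split X_def Y_def M_def by blast
qed

section \<open>Ordering and translating the given sets\<close>

lemma mono_bij_enumeration:
  fixes L :: "nat \<Rightarrow> 'a::linorder"
  obtains g where "bij_betw g {..<m} {1..m}" "\<And>i j. i \<le> j \<Longrightarrow> j < m \<Longrightarrow> L (g i) \<le> L (g j)"
proof -
  define xs where "xs = sort_key L [1..<Suc m]"
  have len: "length xs = m" by (simp add: xs_def)
  have "bij_betw ((!) xs) {..<m} {1..m}"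
  proof (rule bij_betw_nth)
    show "distinct xs" by (simp add: xs_def)
    show "{1..m} = set xs" by (auto simp: xs_def)
  qed (simp add: len)
  moreover have "L (xs ! i) \<le> L (xs ! j)" if "i \<le> j" "j < m" for i j
  proof -
    have "sorted (map L xs)" unfolding xs_def by (rule sorted_sort_key)
    then show ?thesis using sorted_nth_mono [of "map L xs" i j] that len by simp
  qed
  ultimately show ?thesis using that by blast
qed

text \<open>For \<open>\<kappa> = 0\<close> the hypotheses force \<open>l = n - 1\<close> and
  \<open>A 1 = {0..l}\<close>, so the block length is exactly \<open>l\<close>; strictness is
  therefore asserted for \<open>\<kappa> \<ge> 1\<close>.\<close>

theorem theorem4:
  fixes k l n \<kappa> :: int and m :: nat and A :: "nat \<Rightarrow> int set"
  assumes "k \<ge> 1" and "l \<ge> 1" and "n \<ge> 3"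
    and "\<kappa> = \<lceil>real_of_int (l - 1) / real_of_int (n - 2)\<rceil> - 1"
    and "int m = 2 * \<kappa> + 1"
    and "\<And>i. i \<in> {1..m} \<Longrightarrow> A i \<subseteq> {0..l}"
    and "\<And>i. i \<in> {1..m} \<Longrightarrow> int (card (A i)) \<ge> n"
    and "\<And>i. i \<in> {1..m} \<Longrightarrow> \<not> (\<exists>a d N. d > 1 \<and> A i \<subseteq> arith_prog a d N)"
  shows "contains_block (\<Sum>i\<in>{1..m}. A i) (2 * (\<kappa> + 1) * (n - 1) - l)
    \<and> 2 * (\<kappa> + 1) * (n - 1) - l \<ge> l
    \<and> (\<kappa> \<ge> 1 \<longrightarrow> 2 * (\<kappa> + 1) * (n - 1) - l > l)"
proof -
  define K where "K = nat \<kappa>"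
  \<comment> \<open>Since \<open>2 * \<kappa> + 1\<close> is a natural number,
    \<open>\<kappa>\<close> is nonnegative and \<open>nat\<close> loses nothing.\<close>
  have K: "\<kappa> = int K" "m = 2 * K + 1" using assms(5) by (auto simp: K_def)
  have "real_of_int (l - 1) / real_of_int (n - 2) \<le> real_of_int (\<kappa> + 1)"
    using assms(4) by linarith
  then have "real_of_int (l - 1) \<le> real_of_int ((\<kappa> + 1) * (n - 2))"
    using assms(3) by (simp add: field_simps)
  then have l: "l \<le> (\<kappa> + 1) * (n - 2) + 1" by linarith
  define a where "a i = Min (A i)" for i
  define L where "L i = Max (A i) - Min (A i)" for i
  define B where "B i = (\<lambda>x. x - a i) ` A i" for i
  have A: "finite (A i)" "A i \<noteq> {}" if "i \<in> {1..m}" for i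
    using assms(6,7) [OF that] assms(3) finite_subset by auto
  have B: "B i \<subseteq> {0..L i} \<and> 0 \<in> B i \<and> L i \<in> B i \<and> n \<le> int (card (B i)) \<and> L i \<le> l" if i: "i \<in> {1..m}" for i
  proof -
    have "card (B i) = card (A i)" unfolding B_def by (intro card_image inj_onI) auto
    moreover have mm: "Min (A i) \<in> A i" "Max (A i) \<in> A i" using A [OF i] by auto
    moreover have "B i \<subseteq> {0..L i}" using A [OF i] by (auto simp: B_def L_def a_def)
    moreover have "0 \<in> B i" "L i \<in> B i" using mm by (auto simp: B_def L_def a_def)
    moreover have "L i \<le> l" using subsetD [OF assms(6) [OF i] mm(1)] subsetD [OF assms(6) [OF i] mm(2)] by (simp add: L_def)
    ultimately show ?thesis using assms(7) [OF i] by simp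
  qed
  have gen: "\<exists>b\<in>B i. \<not> e dvd b" if i: "i \<in> {1..m}" and e: "e > 1" for i e
  proof (rule ccontr)
    assume "\<not> (\<exists>b\<in>B i. \<not> e dvd b)"
    then have dvd: "e dvd b" if "b \<in> B i" for b using that by blast
    \<comment> \<open>The bound \<open>nat (L i)\<close> on the index is large enough, because
      \<open>j \<le> e * j \<le> L i\<close>.\<close>
    have "A i \<subseteq> arith_prog (a i) e (nat (L i))"
    proof
      fix x assume x: "x \<in> A i"
      then have xB: "x - a i \<in> B i" by (auto simp: B_def)
      then obtain j where j: "x - a i = e * j" using dvd by blast
      have bounds: "0 \<le> e * j" "e * j \<le> L i" using xB B [OF i] j by auto
      then have "0 \<le> j" using e by (simp add: zero_le_mult_iff)
      moreover have "j \<le> e * j" using e \<open>0 \<le> j\<close> by (simp add: mult_le_cancel_right1)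
      ultimately have "nat j \<in> {0..nat (L i)}" "x = a i + int (nat j) * e"
        using bounds j by (auto simp: mult.commute)
      then show "x \<in> arith_prog (a i) e (nat (L i))" unfolding arith_prog_def by blast
    qed
    then show False using assms(8) [OF i] e by blast
  qed
  obtain g where g: "bij_betw g {..<m} {1..m}" "\<And>i j. i \<le> j \<Longrightarrow> j < m \<Longrightarrow> L (g i) \<le> L (g j)"
    using mono_bij_enumeration [of m L] by blast
  have gm: "g i \<in> {1..m}" if "i \<le> 2 * K" for i
    by (rule bij_betw_apply [OF g(1)]) (use that K(2) in simp)
  have "contains_block (\<Sum>i<2 * K + 1. B (g i)) (2 * (int K + 1) * (n - 1) - L (g (2 * K)))"
  proof (rule block_in_odd_sumset)
    show "L (g (2 * K)) \<le> (int K + 1) * (n - 2) + 1"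
      using B [OF gm, of "2 * K"] l K by simp
    show "B (g i) \<subseteq> {0..L (g i)} \<and> 0 \<in> B (g i) \<and> L (g i) \<in> B (g i) \<and> n \<le> int (card (B (g i)))"
      if "i \<le> 2 * K" for i using B [OF gm [OF that]] by blast
    show "L (g i) \<le> L (g j)" if "i \<le> j" "j \<le> 2 * K" for i j using g(2) that K(2) by simp
  qed (use assms(3) gen gm in auto)
  then obtain c where c: "{c..c + (2 * (int K + 1) * (n - 1) - L (g (2 * K)))} \<subseteq> (\<Sum>i<m. B (g i))"
    unfolding contains_block_def K(2) by blast
  have "(\<Sum>i\<in>{1..m}. A i) = (\<Sum>i\<in>{1..m}. {a i} + B i)"
    by (intro sum.cong refl) (auto simp: B_def set_plus_def)
  also have "\<dots> = {\<Sum>i\<in>{1..m}. a i} + (\<Sum>i<m. B (g i))"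
  proof -
    have "(\<Sum>i\<in>I. {a i}) = {\<Sum>i\<in>I. a i}" if "finite I" for I
      using that by (induction I rule: finite_induct) (auto simp: set_zero set_plus_def)
    then show ?thesis using sum.reindex_bij_betw [OF g(1), of B] by (simp add: sum.distrib)
  qed
  finally have sumA: "(\<Sum>i\<in>{1..m}. A i) = {\<Sum>i\<in>{1..m}. a i} + (\<Sum>i<m. B (g i))" .
  define b where "b = (\<Sum>i\<in>{1..m}. a i)"
  \<comment> \<open>Since \<open>L (g (2 * K)) \<le> l\<close>, putting \<open>l\<close> in its
    place only shortens the block.\<close>
  have "{b + c..b + c + (2 * (\<kappa> + 1) * (n - 1) - l)} \<subseteq> (\<Sum>i\<in>{1..m}. A i)"
  proof
    fix x assume "x \<in> {b + c..b + c + (2 * (\<kappa> + 1) * (n - 1) - l)}"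
    then have "x - b \<in> {c..c + (2 * (int K + 1) * (n - 1) - L (g (2 * K)))}"
      using B [OF gm, of "2 * K"] K(1) by auto
    then have "b + (x - b) \<in> {b} + (\<Sum>i<m. B (g i))" using c by blast
    then show "x \<in> (\<Sum>i\<in>{1..m}. A i)" unfolding sumA b_def by simp
  qed
  then have "contains_block (\<Sum>i\<in>{1..m}. A i) (2 * (\<kappa> + 1) * (n - 1) - l)"
    unfolding contains_block_def by blast
  \<comment> \<open>The length thus exceeds \<open>l\<close> by at least
    \<open>2 * \<kappa>\<close>.\<close>
  moreover have "2 * l + 2 * \<kappa> \<le> 2 * (\<kappa> + 1) * (n - 1)" using l by (simp add: algebra_simps)
  ultimately show ?thesis using K(1) by auto
qed

end
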